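(* Let $A>0$ and let $T_t=(\theta_1(t),\theta_2(t),\theta_3(t))$, $t\in[a,b]$, be a continuous family of non-obtuse labeled triangles of area $A$ (a continuous path in $\overline{\mathfrak{AT}_A}$, described by its angles) which is not constant on any subinterval of $[a,b]$. Then $t\mapsto T_t$ is a geodesic in $(\overline{\mathfrak{AT}_A},m)$ if and only if each function $\theta_i(t)$, $i=1,2,3$, is monotone on $[a,b]$ (either non-decreasing or non-increasing).
   Context: A labeled triangle is a (non-degenerate) Euclidean triangle with vertices labeled $v_1,v_2,v_3$ in counter-clockwise order; $e_i$ is the edge opposite $v_i$, with length $\|e_i\|$, $h_i$ the altitude from $v_i$, with length $\|h_i\|$, and $\theta_i$ the angle at $v_i$. A triangle is non-obtuse if all its angles are at most $\pi/2$. $\overline{\mathfrak{AT}_A}$ denotes the set of labeled non-obtuse triangles of area $A$ modulo label-respecting isometry. Each element is determined by its triple of angles $(\theta_1,\theta_2,\theta_3)$ with $0<\theta_i\le\pi/2$ and $\theta_1+\theta_2+\theta_3=\pi$ (the angle model), and $(\theta_1,\theta_2,\theta_3)$ denotes the triangle of area $A$ with these angles. The metric is $$m(T,T')=\log\Big(\max\Big\{\tfrac{\|e_1'\|}{\|e_1\|},\tfrac{\|e_2'\|}{\|e_2\|},\tfrac{\|e_3'\|}{\|e_3\|},\tfrac{\|h_1'\|}{\|h_1\|},\tfrac{\|h_2'\|}{\|h_2\|},\tfrac{\|h_3'\|}{\|h_3\|}\Big\}\Big),$$ where primed symbols refer to $T'$; on triangles of equal area this equals $\max_i|\log\|e_i'\|-\log\|e_i\||$.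 A geodesic in a metric space $(X,d)$ is a map $h:I\to X$, $I$ an interval of $\mathbb{R}$, such that $d(h(x_1),h(x_3))=d(h(x_1),h(x_2))+d(h(x_2),h(x_3))$ for all $x_1\le x_2\le x_3$ in $I$, and such that $h$ is not constant on any subinterval (of positive length) of $I$. *)

theory Defs
  imports "HOL-Analysis.Analysis"
begin

text \<open>
  The vertices $v_1, v_2, v_3$ are indexed by the cyclic type \<^typ>\<open>3\<close> (in which \<open>3 = 0\<close>), so
  for every vertex \<open>i\<close> the other two vertices are \<open>i + 1\<close> and \<open>i + 2\<close>.
\<close>

text \<open>
  The determinant is twice the signed area, so its positivity also expresses non-degeneracy.
\<close>

definition counterclockwise :: "(3 \<Rightarrow> real ^ 2) \<Rightarrow> bool" where
  "counterclockwise v \<longleftrightarrow>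
     (v 2 - v 1) $ 1 * (v 3 - v 1) $ 2 - (v 2 - v 1) $ 2 * (v 3 - v 1) $ 1 > 0"

definition plane_isometry :: "(real ^ 2 \<Rightarrow> real ^ 2) \<Rightarrow> bool" where
  "plane_isometry f \<longleftrightarrow> bij f \<and> (\<forall>x y. dist (f x) (f y) = dist x y)"

definition isometric_triangles :: "(3 \<Rightarrow> real ^ 2) \<Rightarrow> (3 \<Rightarrow> real ^ 2) \<Rightarrow> bool" where
  "isometric_triangles v w \<longleftrightarrow>
     counterclockwise v \<and> counterclockwise w \<and> (\<exists>f. plane_isometry f \<and> w = f \<circ> v)"

quotient_type triangle = "3 \<Rightarrow> real ^ 2" / partial: isometric_triangles
proof (rule part_equivpI)
  define v :: "3 \<Rightarrow> real ^ 2" where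
    "v = (\<lambda>i. if i = 1 then 0 else if i = 2 then axis 1 1 else axis 2 1)"
  have "counterclockwise v"
    by (simp add: v_def counterclockwise_def axis_def)
  moreover have "plane_isometry id"
    by (simp add: plane_isometry_def)
  ultimately have "isometric_triangles v v"
    unfolding isometric_triangles_def by (metis id_comp)
  then show "\<exists>v. isometric_triangles v v" by blast
next
  show "symp isometric_triangles"
  proof (rule sympI)
    fix v w assume vw: "isometric_triangles v w"
    then obtain f where f: "plane_isometry f" "w = f \<circ> v"
      by (auto simp: isometric_triangles_def)
    then have "plane_isometry (inv f)"
      unfolding plane_isometry_def by (metis bij_imp_bij_inv bij_inv_eq_iff)
    moreover have "v = inv f \<circ> w"
      using f by (auto simp: plane_isometry_def bij_def fun_eq_iff)
    ultimately show "isometric_triangles w v"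
      using vw by (auto simp: isometric_triangles_def)
  qed
next
  show "transp isometric_triangles"
  proof (rule transpI)
    fix u v w assume uv: "isometric_triangles u v" and vw: "isometric_triangles v w"
    obtain f where f: "plane_isometry f" "v = f \<circ> u"
      using uv by (auto simp: isometric_triangles_def)
    obtain g where g: "plane_isometry g" "w = g \<circ> v"
      using vw by (auto simp: isometric_triangles_def)
    have "plane_isometry (g \<circ> f)"
      using f g by (auto simp: plane_isometry_def bij_comp)
    moreover have "w = (g \<circ> f) \<circ> u"
      using f g by (simp add: comp_assoc)
    ultimately show "isometric_triangles u w"
      using uv vw unfolding isometric_triangles_def by blast
  qed
qed

lemma plane_isometry_decompose:
  assumes "plane_isometry f"
  obtains g c where "orthogonal_transformation g" "f = (\<lambda>x. c + g x)"
proof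
  show "orthogonal_transformation (\<lambda>x. f x - f 0)"
    using assms by (auto simp: orthogonal_transformation_isometry plane_isometry_def dist_norm)
  show "f = (\<lambda>x. f 0 + (f x - f 0))" by simp
qed

lift_definition edge_length :: "triangle \<Rightarrow> 3 \<Rightarrow> real" is
  "\<lambda>v i. dist (v (i + 1)) (v (i + 2))"
  by (auto simp: isometric_triangles_def plane_isometry_def)

lift_definition altitude_length :: "triangle \<Rightarrow> 3 \<Rightarrow> real" is
  "\<lambda>v i. infdist (v i) (affine hull {v (i + 1), v (i + 2)})"
proof -
  fix v w assume "isometric_triangles v w"
  then obtain f where f: "plane_isometry f" "w = f \<circ> v"
    by (auto simp: isometric_triangles_def)
  obtain g c where g: "orthogonal_transformation g" "f = (\<lambda>x. c + g x)"
    using plane_isometry_decompose f(1) by blast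
  have hull: "affine hull (f ` S) = f ` (affine hull S)" for S
  proof -
    have "affine hull ((\<lambda>x. c + x) ` g ` S) = (\<lambda>x. c + x) ` g ` (affine hull S)"
      using g(1) by (simp add: affine_hull_translation affine_hull_linear_image
          orthogonal_transformation_linear linear_linear)
    then show ?thesis by (simp add: g(2) image_image)
  qed
  have "infdist (f x) (f ` S) = infdist x S" for x S
    using f(1) by (simp add: infdist_def plane_isometry_def image_image)
  then show "(\<lambda>i. infdist (v i) (affine hull {v (i + 1), v (i + 2)})) =
             (\<lambda>i. infdist (w i) (affine hull {w (i + 1), w (i + 2)}))"
    using hull[of "{v (i + 1), v (i + 2)}" for i] by (simp add: f(2))
qed

lift_definition angle :: "triangle \<Rightarrow> 3 \<Rightarrow> real" is
  "\<lambda>v i. arccos (((v (i + 1) - v i) \<bullet> (v (i + 2) - v i)) /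
                  (norm (v (i + 1) - v i) * norm (v (i + 2) - v i)))"
proof -
  fix v w assume "isometric_triangles v w"
  then obtain f where f: "plane_isometry f" "w = f \<circ> v"
    by (auto simp: isometric_triangles_def)
  obtain g c where g: "orthogonal_transformation g" "f = (\<lambda>x. c + g x)"
    using plane_isometry_decompose f(1) by blast
  have "w i - w j = g (v i - v j)" for i j
    using g f(2) by (simp add: orthogonal_transformation_linear linear_diff)
  then show "(\<lambda>i. arccos (((v (i + 1) - v i) \<bullet> (v (i + 2) - v i)) /
                  (norm (v (i + 1) - v i) * norm (v (i + 2) - v i)))) =
             (\<lambda>i. arccos (((w (i + 1) - w i) \<bullet> (w (i + 2) - w i)) /
                  (norm (w (i + 1) - w i) * norm (w (i + 2) - w i))))"
    using g(1) by (simp add: orthogonal_transformation_def orthogonal_transformation_norm)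
qed

lift_definition area :: "triangle \<Rightarrow> real" is
  "\<lambda>v. measure lebesgue (convex hull (range v))"
proof -
  fix v w assume "isometric_triangles v w"
  then obtain f where f: "plane_isometry f" "w = f \<circ> v"
    by (auto simp: isometric_triangles_def)
  obtain g c where g: "orthogonal_transformation g" "f = (\<lambda>x. c + g x)"
    using plane_isometry_decompose f(1) by blast
  have "range w = (\<lambda>x. c + x) ` g ` range v"
    by (auto simp: f(2) g(2))
  then have "convex hull (range w) = (\<lambda>x. c + x) ` g ` (convex hull (range v))"
    using g(1) by (simp add: convex_hull_translation convex_hull_linear_image
        orthogonal_transformation_linear)
  moreover have "convex hull (range v) \<in> lmeasurable"
    by (intro lmeasurable_compact finite_imp_compact_convex_hull) simp
  ultimately show "measure lebesgue (convex hull (range v)) = measure lebesgue (convex hull (range w))"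
    using g(1) by (simp add: measure_translation measure_orthogonal_image)
qed

definition nonobtuse_triangles :: "real \<Rightarrow> triangle set" where
  "nonobtuse_triangles A = {T. area T = A \<and> (\<forall>i. angle T i \<le> pi / 2)}"

text \<open>
  Not symmetric in general, but symmetric (and a metric) on triangles of equal area.
\<close>

definition triangle_dist :: "triangle \<Rightarrow> triangle \<Rightarrow> real" where
  "triangle_dist T T' =
     ln (Max (range (\<lambda>i. edge_length T' i / edge_length T i) \<union>
              range (\<lambda>i. altitude_length T' i / altitude_length T i)))"

definition nowhere_constant_on :: "real set \<Rightarrow> (real \<Rightarrow> 'a) \<Rightarrow> bool" where
  "nowhere_constant_on I h \<longleftrightarrow>
     (\<forall>J. J \<subseteq> I \<and> is_interval J \<and> (\<exists>x\<in>J. \<exists>y\<in>J. x < y) \<longrightarrow> \<not> h constant_on J)"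

definition continuous_path_on :: "('a \<Rightarrow> 'a \<Rightarrow> real) \<Rightarrow> real set \<Rightarrow> (real \<Rightarrow> 'a) \<Rightarrow> bool" where
  "continuous_path_on d I h \<longleftrightarrow> (\<forall>s\<in>I. ((\<lambda>t. d (h s) (h t)) \<longlongrightarrow> 0) (at s within I))"

definition geodesic_on :: "'a set \<Rightarrow> ('a \<Rightarrow> 'a \<Rightarrow> real) \<Rightarrow> real set \<Rightarrow> (real \<Rightarrow> 'a) \<Rightarrow> bool" where
  "geodesic_on X d I h \<longleftrightarrow>
     is_interval I \<and> h ` I \<subseteq> X \<and>
     (\<forall>x\<^sub>1\<in>I. \<forall>x\<^sub>2\<in>I. \<forall>x\<^sub>3\<in>I. x\<^sub>1 \<le> x\<^sub>2 \<and> x\<^sub>2 \<le> x\<^sub>3 \<longrightarrow>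
        d (h x\<^sub>1) (h x\<^sub>3) = d (h x\<^sub>1) (h x\<^sub>2) + d (h x\<^sub>2) (h x\<^sub>3)) \<and>
     nowhere_constant_on I h"

end

theory Submission
  imports Defs
begin

text \<open>
  The area formula $\|e_j\| \|e_k\| \sin\theta_i = 2A$, the monotonicity of the sine on
  $[0, \pi/2]$ and the angle sum give, for non-obtuse triangles of area $A$,
  $m(T,T') = \log\|e_i\| - \log\|e_i'\|$ if and only if $\theta_j \le \theta_j'$ and
  $\theta_k \le \theta_k'$ (whence $\theta_i \ge \theta_i'$). Since $m$ is the maximum of the
  $|\log\|e_i'\| - \log\|e_i\||$, a geodesic attains this maximum with one and the same index and
  sign for all pairs of parameters, namely with those that work for the two endpoints.
  Conversely, of three monotone angles two vary in the same direction, so $m$ is, up to sign, the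
  increment of the logarithm of one edge length and therefore additive.
\<close>

subsection \<open>The geometry of a triangle\<close>

text \<open>The planar determinant; on the two edge vectors at a vertex it is twice the signed area,
  in agreement with \<open>counterclockwise\<close>.\<close>

definition cross2 :: "real ^ 2 \<Rightarrow> real ^ 2 \<Rightarrow> real" where
  "cross2 u w = u $ 1 * w $ 2 - u $ 2 * w $ 1"

text \<open>Lagrange's identity in the plane, that is, cos^2 + sin^2 = 1 multiplied by the squared
  lengths.\<close>

lemma norm_mult_norm_sq: "(norm u * norm w)\<^sup>2 = (u \<bullet> w)\<^sup>2 + (cross2 u w)\<^sup>2"
  for u w :: "real ^ 2"
  by (simp add: power_mult_distrib power2_norm_eq_inner)
     (simp add: inner_vec_def UNIV_2 cross2_def power2_eq_square algebra_simps)

lemma add_simps_3: "i + 1 + 1 = i + 2" "i + 1 + 2 = i" "i + 2 + 1 = i" "i + 2 + 2 = i + 1" for i :: 3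
  using exhaust_3[of i] by auto

lemma numeral_3_eq: "(4 :: 3) = 1" "(5 :: 3) = 2"
  by simp_all

lemma cyclic_exhaust_3: "j = i \<or> j = i + 1 \<or> j = i + 2" for i j :: 3
  using exhaust_3[of i] exhaust_3[of j] by (auto simp: numeral_3_eq)

text \<open>The determinant does not change under cyclic relabeling of the vertices, so positivity
  passes from vertex 1 to every vertex.\<close>

lemma counterclockwise_cross2:
  assumes "counterclockwise v"
  shows "cross2 (v (i + 1) - v i) (v (i + 2) - v i) = cross2 (v 2 - v 1) (v 3 - v 1)"
    and "cross2 (v (i + 1) - v i) (v (i + 2) - v i) > 0"
proof -
  show *: "cross2 (v (i + 1) - v i) (v (i + 2) - v i) = cross2 (v 2 - v 1) (v 3 - v 1)" for i
    using exhaust_3[of i] by (auto simp: cross2_def numeral_3_eq algebra_simps)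
  show "cross2 (v (i + 1) - v i) (v (i + 2) - v i) > 0"
    using assms unfolding * by (simp add: counterclockwise_def cross2_def)
qed

text \<open>Base times height is twice the area. For a point moving on the line,
  \<open>norm_mult_norm_sq\<close> splits the squared product of its distance from \<open>p\<close>
  and the base into a variable square and the constant squared determinant.\<close>

lemma infdist_line_mult:
  fixes p q r :: "real ^ 2"
  assumes "q \<noteq> r"
  shows "infdist p (affine hull {q, r}) * dist q r = \<bar>cross2 (q - p) (r - p)\<bar>"
proof -
  let ?L = "affine hull {q, r}" and ?c = "\<bar>cross2 (q - p) (r - p)\<bar>"
  have pos: "dist q r > 0" using assms by simp
  have sq: "(dist p (q + t *\<^sub>R (r - q)) * dist q r)\<^sup>2
      = ((q + t *\<^sub>R (r - q) - p) \<bullet> (r - q))\<^sup>2 + ?c\<^sup>2" for t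
  proof -
    have "cross2 (q + t *\<^sub>R (r - q) - p) (r - q) = cross2 (q - p) (r - p)"
      by (simp add: cross2_def algebra_simps)
    then show ?thesis
      using norm_mult_norm_sq[of "q + t *\<^sub>R (r - q) - p" "r - q"]
      by (simp add: dist_norm norm_minus_commute)
  qed
  have line: "y \<in> ?L \<longleftrightarrow> (\<exists>t. y = q + t *\<^sub>R (r - q))" for y
  proof
    assume "y \<in> ?L"
    then obtain u t where "y = u *\<^sub>R q + t *\<^sub>R r" "u + t = 1" by (auto simp: affine_hull_2)
    then have "y = q + t *\<^sub>R (r - q)" by (simp add: algebra_simps flip: scaleR_add_left)
    then show "\<exists>t. y = q + t *\<^sub>R (r - q)" ..
  next
    assume "\<exists>t. y = q + t *\<^sub>R (r - q)"
    then obtain t where "y = q + t *\<^sub>R (r - q)" ..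
    then have "y = (1 - t) *\<^sub>R q + t *\<^sub>R r" by (simp add: algebra_simps)
    then show "y \<in> ?L" unfolding affine_hull_2 by (smt (verit) mem_Collect_eq)
  qed
  have "?c / dist q r \<le> dist p y" if y: "y \<in> ?L" for y
  proof -
    obtain t where t: "y = q + t *\<^sub>R (r - q)" using y line by blast
    have "?c\<^sup>2 \<le> (dist p y * dist q r)\<^sup>2" using sq[of t] t by simp
    then have "?c \<le> dist p y * dist q r" by (rule power2_le_imp_le) simp
    then show ?thesis using pos by (simp add: field_simps)
  qed
  moreover have ne: "?L \<noteq> {}" by simp
  ultimately have "?c / dist q r \<le> infdist p ?L"
    unfolding infdist_notempty[OF ne] by (intro cINF_greatest) auto
  moreover have "infdist p ?L \<le> ?c / dist q r"
  proof -
    \<comment> \<open>Parameter of the foot of the perpendicular: the inner product, the only part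
      of \<open>sq\<close> that depends on \<open>t\<close>, vanishes there.\<close>
    define t where "t = - ((q - p) \<bullet> (r - q)) / ((r - q) \<bullet> (r - q))"
    have "(q + t *\<^sub>R (r - q) - p) \<bullet> (r - q) = (q - p) \<bullet> (r - q) + t * ((r - q) \<bullet> (r - q))"
      by (simp add: algebra_simps)
    also have "\<dots> = 0" using assms by (simp add: t_def)
    finally have "(dist p (q + t *\<^sub>R (r - q)) * dist q r)\<^sup>2 = ?c\<^sup>2" using sq[of t] by simp
    then have "dist p (q + t *\<^sub>R (r - q)) * dist q r = ?c" by (rule power2_eq_imp_eq) simp_all
    then have "dist p (q + t *\<^sub>R (r - q)) = ?c / dist q r" using pos by (simp add: field_simps)
    moreover have "q + t *\<^sub>R (r - q) \<in> ?L" using line by blast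
    ultimately show ?thesis by (metis infdist_le)
  qed
  ultimately have "infdist p ?L = ?c / dist q r" by simp
  then show ?thesis using pos by simp
qed

section \<open>Areas, sines and cosines of labeled triangles\<close>

lemma triangle_representative:
  obtains v where "counterclockwise v" "isometric_triangles v v" "T = abs_triangle v"
proof -
  have "isometric_triangles (rep_triangle T) (rep_triangle T)" "T = abs_triangle (rep_triangle T)"
    using Quotient3_rep_reflp[OF Quotient3_triangle] Quotient3_abs_rep[OF Quotient3_triangle] by simp_all
  then show thesis using that by (auto simp: isometric_triangles_def)
qed

text \<open>The orientation of the representative makes the determinant positive, which removes the
  absolute value from \<open>content_triangle\<close>.\<close>

lemma area_abs_triangle:
  assumes "isometric_triangles v v"
  shows "2 * area (abs_triangle v) = cross2 (v 2 - v 1) (v 3 - v 1)"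
proof -
  have ccw: "counterclockwise v" using assms by (simp add: isometric_triangles_def)
  have "area (abs_triangle v) = measure lebesgue (convex hull {v 1, v 2, v 3})"
    using assms by (simp add: area.abs_eq UNIV_3)
  also have "\<dots> = measure lborel (convex hull {v 1, v 2, v 3})"
    by (rule measure_completion)
       (simp add: borel_compact finite_imp_compact_convex_hull)
  also have "\<dots> = \<bar>cross2 (v 2 - v 1) (v 3 - v 1)\<bar> / 2"
    unfolding content_triangle by (simp add: cross2_def abs_minus_commute algebra_simps)
  finally show ?thesis using counterclockwise_cross2(2)[OF ccw, of 1] by simp
qed

text \<open>\<open>S i\<close> is the inner product of the two edge vectors that start at the vertex \<open>i\<close>.\<close>

lemma triangle_measurements:
  obtains S where
    "\<And>i. edge_length T i > 0"
    "\<And>i. edge_length T i * altitude_length T i = 2 * area T"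
    "area T > 0"
    "\<And>i. 0 < angle T i" "\<And>i. angle T i < pi"
    "\<And>i. edge_length T (i + 1) * edge_length T (i + 2) * sin (angle T i) = 2 * area T"
    "\<And>i. edge_length T (i + 1) * edge_length T (i + 2) * cos (angle T i) = S i"
    "\<And>i. S (i + 1) + S (i + 2) = (edge_length T i)\<^sup>2"
    "\<And>i. S i * (S (i + 1) + S (i + 2)) + S (i + 1) * S (i + 2) = (2 * area T)\<^sup>2"
proof -
  obtain v where v: "counterclockwise v" "isometric_triangles v v" "T = abs_triangle v"
    by (rule triangle_representative)
  define S where "S i = (v (i + 1) - v i) \<bullet> (v (i + 2) - v i)" for i
  define D where "D = cross2 (v 2 - v 1) (v 3 - v 1)"
  have D: "2 * area T = D" using area_abs_triangle[OF v(2)] v(3) by (simp add: D_def)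
  have cr: "cross2 (v (i + 1) - v i) (v (i + 2) - v i) = D" for i
    using counterclockwise_cross2(1)[OF v(1)] D_def by simp
  have D0: "D > 0" using counterclockwise_cross2(2)[OF v(1), of 1] cr[of 1] by simp
  have e: "edge_length T i = norm (v (i + 1) - v (i + 2))" for i
    using v by (simp add: edge_length.abs_eq dist_norm)
  have e1: "edge_length T (i + 1) = norm (v (i + 2) - v i)" for i
    by (simp only: e add_simps_3)
  have e2: "edge_length T (i + 2) = norm (v (i + 1) - v i)" for i
    by (simp only: e add_simps_3 norm_minus_commute)
  have sq: "(edge_length T (i + 1) * edge_length T (i + 2))\<^sup>2 = (S i)\<^sup>2 + D\<^sup>2" for i
    using norm_mult_norm_sq[of "v (i + 1) - v i" "v (i + 2) - v i"]
    by (simp add: e1 e2 S_def cr mult.commute)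
  have ne: "v (i + 1) \<noteq> v (i + 2)" for i
    using cr[of i] D0 by (auto simp: cross2_def)
  have epos: "edge_length T i > 0" for i using ne by (simp add: e)
  have ang: "angle T i = arccos (S i / (edge_length T (i + 1) * edge_length T (i + 2)))" for i
    unfolding e1 e2 S_def using v
    by (simp add: angle.abs_eq mult.commute[of "norm (v (i + 2) - v i)"])
  \<comment> \<open>A right triangle with hypotenuse \<open>n\<close> and legs of lengths
    \<open>|s|\<close> and \<open>D\<close>; \<open>D > 0\<close> keeps the angle strictly between 0
    and pi.\<close>
  have trig: "n * cos (arccos (s / n)) = s \<and> n * sin (arccos (s / n)) = D \<and>
      0 < arccos (s / n) \<and> arccos (s / n) < pi"
    if n: "n > 0" "n\<^sup>2 = s\<^sup>2 + D\<^sup>2" for n s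
  proof -
    have "\<bar>s\<bar> < n"
      by (rule power2_less_imp_less) (use n D0 in auto)
    then have lt: "-1 < s / n" "s / n < 1" using n by (auto simp: field_simps)
    have "D\<^sup>2 = n\<^sup>2 - s\<^sup>2" using n(2) by simp
    then have "1 - (s / n)\<^sup>2 = (D / n)\<^sup>2"
      using n(1) by (simp add: power_divide diff_divide_distrib)
    then have "sin (arccos (s / n)) = D / n" using lt D0 n by (simp add: sin_arccos)
    moreover have "cos (arccos (s / n)) = s / n" using lt by simp
    moreover have "0 < arccos (s / n)" "arccos (s / n) < pi"
      using arccos_lt_bounded[OF lt] by auto
    ultimately show ?thesis using n(1) by auto
  qed
  have trig': "edge_length T (i + 1) * edge_length T (i + 2) * cos (angle T i) = S i \<and>
      edge_length T (i + 1) * edge_length T (i + 2) * sin (angle T i) = D \<and>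
      0 < angle T i \<and> angle T i < pi" for i
    unfolding ang by (rule trig) (simp_all add: epos sq)
  have alt: "edge_length T i * altitude_length T i = D" for i
    using infdist_line_mult[OF ne[of i], of "v i"] v(2) D0 unfolding v(3)
    by (simp add: altitude_length.abs_eq edge_length.abs_eq cr mult.commute)
  have S12: "S (i + 1) = (v (i + 2) - v (i + 1)) \<bullet> (v i - v (i + 1))"
    "S (i + 2) = (v i - v (i + 2)) \<bullet> (v (i + 1) - v (i + 2))" for i
    by (simp_all only: S_def add_simps_3)
  have sum: "S (i + 1) + S (i + 2) = (edge_length T i)\<^sup>2" for i
    unfolding S12 e power2_norm_eq_inner
    by (simp add: inner_diff_left inner_diff_right inner_commute)
  \<comment> \<open>The \<open>S i\<close> are the Conway parameters of the triangle. Written in the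
    two edge vectors at vertex \<open>i\<close>, the identity is again that of Lagrange.\<close>
  have prod: "S i * (S (i + 1) + S (i + 2)) + S (i + 1) * S (i + 2) = D\<^sup>2" for i
    unfolding S12[of i] unfolding S_def cr[of i, symmetric]
    by (simp add: inner_vec_def UNIV_2 cross2_def power2_eq_square algebra_simps)
  show thesis
    by (rule that[of S]) (use epos alt D D0 trig' sum prod in auto)
qed

lemma edge_length_pos [simp]: "edge_length T i > 0"
  using triangle_measurements[of T] by metis

lemma edge_length_mult_altitude_length: "edge_length T i * altitude_length T i = 2 * area T"
  using triangle_measurements[of T] by metis

lemma area_pos [simp]: "area T > 0"
  using triangle_measurements[of T] by metis

lemma angle_pos: "0 < angle T i" and angle_less_pi: "angle T i < pi"
  using triangle_measurements[of T] by metis+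

lemma edge_edge_sin_angle:
  "edge_length T (i + 1) * edge_length T (i + 2) * sin (angle T i) = 2 * area T"
  using triangle_measurements[of T] by metis

text \<open>The addition formulas, fed with the measured sines and cosines, show that pi minus two
  of the angles has the same cosine as the third; cosine is injective on [0, pi].\<close>

lemma angle_sum: "angle T i + angle T (i + 1) + angle T (i + 2) = pi"
proof -
  obtain S where cos: "\<And>i. edge_length T (i + 1) * edge_length T (i + 2) * cos (angle T i) = S i"
    and sum: "\<And>i. S (i + 1) + S (i + 2) = (edge_length T i)\<^sup>2"
    and prod: "\<And>i. S i * (S (i + 1) + S (i + 2)) + S (i + 1) * S (i + 2) = (2 * area T)\<^sup>2"
    using triangle_measurements[of T] by metis
  define x y z where "x = edge_length T i" "y = edge_length T (i + 1)" "z = edge_length T (i + 2)"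
  define D where "D = 2 * area T"
  note defs = x_y_z_def D_def
  have pos: "x > 0" "y > 0" "z > 0" "D > 0" by (simp_all add: defs)
  have div: "c = p / n" if "n * c = p" "n > 0" for c p n :: real
    using that by auto
  have "y * z * cos (angle T i) = S i" "x * z * cos (angle T (i + 1)) = S (i + 1)"
    "x * y * cos (angle T (i + 2)) = S (i + 2)"
    using cos[of i] cos[of "i + 1"] cos[of "i + 2"] unfolding add_simps_3 defs
    by (simp_all add: mult_ac)
  then have c: "cos (angle T i) = S i / (y * z)" "cos (angle T (i + 1)) = S (i + 1) / (x * z)"
    "cos (angle T (i + 2)) = S (i + 2) / (x * y)"
    using pos by (auto intro!: div)
  have "y * z * sin (angle T i) = D" "x * z * sin (angle T (i + 1)) = D"
    "x * y * sin (angle T (i + 2)) = D"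
    using edge_edge_sin_angle[of T i] edge_edge_sin_angle[of T "i + 1"]
      edge_edge_sin_angle[of T "i + 2"]
    unfolding add_simps_3 defs by (simp_all add: mult_ac)
  then have s: "sin (angle T i) = D / (y * z)" "sin (angle T (i + 1)) = D / (x * z)"
    "sin (angle T (i + 2)) = D / (x * y)"
    using pos by (auto intro!: div)
  have S: "S (i + 1) + S (i + 2) = x\<^sup>2" "S i * x\<^sup>2 + S (i + 1) * S (i + 2) = D\<^sup>2"
    using sum[of i] prod[of i] by (simp_all add: defs)
  let ?\<beta> = "angle T (i + 1) + angle T (i + 2)"
  have "sin ?\<beta> = D * (S (i + 1) + S (i + 2)) / (x\<^sup>2 * y * z)"
    unfolding sin_add c s using pos by (simp add: field_simps power2_eq_square)
  \<comment> \<open>A sum of two angles below pi lies below 2 pi, so a positive sine leaves only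
    values below pi.\<close>
  then have "sin ?\<beta> > 0" using pos by (simp add: S)
  then have "?\<beta> < pi"
    using sin_le_zero[of ?\<beta>] angle_less_pi[of T "i + 1"] angle_less_pi[of T "i + 2"]
    by linarith
  moreover have "cos (pi - ?\<beta>) = cos (angle T i)"
  proof -
    have "cos (pi - ?\<beta>) = (D\<^sup>2 - S (i + 1) * S (i + 2)) / (x\<^sup>2 * y * z)"
      unfolding cos_diff cos_add c s using pos by (simp add: field_simps power2_eq_square)
    \<comment> \<open>By the second equation of \<open>S\<close> the numerator is \<open>S i\<close>
      times \<open>x^2\<close>.\<close>
    also have "\<dots> = cos (angle T i)"
      using pos S(2)[symmetric] by (simp add: c)
    finally show ?thesis .
  qed
  moreover have "?\<beta> > 0" by (intro add_pos_pos angle_pos)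
  ultimately have "pi - ?\<beta> = angle T i"
    using angle_pos[of T i] angle_less_pi[of T i] cos_inj_pi[of "pi - ?\<beta>" "angle T i"] by linarith
  then show ?thesis by simp
qed

subsection \<open>The distance of non-obtuse triangles of equal area\<close>

text \<open>Coordinates in which the metric on triangles of equal area becomes the maximum
  distance.\<close>

definition log_edge :: "triangle \<Rightarrow> 3 \<Rightarrow> real" where
  "log_edge T i = ln (edge_length T i)"

lemma ln_edge_length_ratio: "ln (edge_length T' i / edge_length T i) = log_edge T' i - log_edge T i"
  by (simp add: log_edge_def ln_divide_pos)

text \<open>For equal areas the altitudes are inversely proportional to the edges, so the altitude
  ratios are the inverse edge ratios; the two signs of the logarithm combine to an absolute
  value.\<close>

lemma triangle_dist_eq_Max:
  assumes "area T = area T'"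
  shows "triangle_dist T T' = Max (range (\<lambda>i. \<bar>log_edge T' i - log_edge T i\<bar>))"
proof (rule Max_eqI[symmetric])
  define R where "R = range (\<lambda>i. edge_length T' i / edge_length T i) \<union>
    range (\<lambda>i. altitude_length T' i / altitude_length T i)"
  have alt: "altitude_length T i = 2 * area T / edge_length T i" for T i
    using edge_length_mult_altitude_length[of T i, symmetric] less_imp_neq[OF edge_length_pos[of T i]]
    by simp
  have "altitude_length T' i / altitude_length T i = edge_length T i / edge_length T' i" for i
    unfolding alt assms using less_imp_neq[OF area_pos[of T']] by simp
  then have R: "R = range (\<lambda>i. edge_length T' i / edge_length T i) \<union>
      range (\<lambda>i. edge_length T i / edge_length T' i)"
    by (simp add: R_def)
  have dist: "triangle_dist T T' = ln (Max R)" by (simp add: triangle_dist_def R_def)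
  have pos: "r > 0" if "r \<in> R" for r using that by (auto simp: R)
  have fin: "finite R" "R \<noteq> {}" by (simp_all add: R)
  have ge: "ln r \<le> triangle_dist T T'" if "r \<in> R" for r
    unfolding dist using that fin pos by (simp add: ln_mono)
  show upper: "y \<le> triangle_dist T T'" if y: "y \<in> range (\<lambda>i. \<bar>log_edge T' i - log_edge T i\<bar>)" for y
  proof -
    obtain i where i: "y = \<bar>log_edge T' i - log_edge T i\<bar>" using y by blast
    have "log_edge T' i - log_edge T i \<le> triangle_dist T T'"
      "log_edge T i - log_edge T' i \<le> triangle_dist T T'"
      using ge[of "edge_length T' i / edge_length T i"] ge[of "edge_length T i / edge_length T' i"]
      by (auto simp: R ln_edge_length_ratio)
    then show ?thesis by (simp add: i)
  qed
  have "Max R \<in> R" using fin by (rule Max_in)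
  then obtain i where "Max R = edge_length T' i / edge_length T i \<or>
      Max R = edge_length T i / edge_length T' i"
    unfolding R by blast
  then have "triangle_dist T T' = log_edge T' i - log_edge T i \<or>
      triangle_dist T T' = log_edge T i - log_edge T' i"
    by (auto simp: dist ln_edge_length_ratio)
  then have "triangle_dist T T' \<le> \<bar>log_edge T' i - log_edge T i\<bar>" by linarith
  then have "triangle_dist T T' = \<bar>log_edge T' i - log_edge T i\<bar>"
    using upper[OF rangeI, of i] by linarith
  then show "triangle_dist T T' \<in> range (\<lambda>i. \<bar>log_edge T' i - log_edge T i\<bar>)" by blast
qed simp

lemma triangle_dist_commute:
  "area T = area T' \<Longrightarrow> triangle_dist T T' = triangle_dist T' T"
  by (simp add: triangle_dist_eq_Max abs_minus_commute)

lemma triangle_dist_ge: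
  "area T = area T' \<Longrightarrow> \<bar>log_edge T' i - log_edge T i\<bar> \<le> triangle_dist T T'"
  by (simp add: triangle_dist_eq_Max)

lemma triangle_dist_cases:
  assumes "area T = area T'"
  obtains i where "triangle_dist T T' = \<bar>log_edge T' i - log_edge T i\<bar>"
proof -
  have "Max (range (\<lambda>i. \<bar>log_edge T' i - log_edge T i\<bar>)) \<in> range (\<lambda>i. \<bar>log_edge T' i - log_edge T i\<bar>)"
    by (rule Max_in) simp_all
  then show thesis using that unfolding triangle_dist_eq_Max[OF assms] by blast
qed

section \<open>Comparing angles through the logarithms of the edge lengths\<close>

lemma log_edge_add:
  "log_edge T (i + 1) + log_edge T (i + 2) = ln (2 * area T) - ln (sin (angle T i))"
proof -
  have "sin (angle T i) > 0" by (simp add: angle_pos angle_less_pi sin_gt_zero)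
  then have "ln (2 * area T) = log_edge T (i + 1) + log_edge T (i + 2) + ln (sin (angle T i))"
    unfolding edge_edge_sin_angle[of T i, symmetric] log_edge_def
    by (simp add: ln_mult_pos)
  then show ?thesis by simp
qed

text \<open>At fixed area only the sine in \<open>log_edge_add\<close> varies. It is increasing
  because the angles lie in [0, pi/2]; the minus sign in front of its logarithm reverses the
  order.\<close>

lemma log_edge_add_le_iff:
  assumes "T \<in> nonobtuse_triangles A" "T' \<in> nonobtuse_triangles A"
  shows "log_edge T' (i + 1) + log_edge T' (i + 2) \<le> log_edge T (i + 1) + log_edge T (i + 2)
    \<longleftrightarrow> angle T i \<le> angle T' i"
proof -
  have pos: "sin (angle T i) > 0" for T by (simp add: angle_pos angle_less_pi sin_gt_zero)
  have "sin (angle T i) \<le> sin (angle T' i) \<longleftrightarrow> angle T i \<le> angle T' i"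
    using assms angle_pos[of T i] angle_pos[of T' i]
    by (intro sin_mono_le_eq) (auto simp: nonobtuse_triangles_def intro: order_trans[of _ 0])
  then show ?thesis
    using assms pos by (simp add: log_edge_add nonobtuse_triangles_def)
qed

text \<open>The distance equals the signed difference \<open>d i\<close> exactly when
  \<open>d i\<close> dominates every \<open>|d j|\<close>. The lower bounds
  \<open>- d i \<le> d j\<close> are the two angle inequalities, and the upper bounds follow from
  the third angle.\<close>

lemma triangle_dist_eq_log_edge_diff_iff:
  assumes "T \<in> nonobtuse_triangles A" "T' \<in> nonobtuse_triangles A"
  shows "triangle_dist T T' = log_edge T i - log_edge T' i
    \<longleftrightarrow> angle T (i + 1) \<le> angle T' (i + 1) \<and> angle T (i + 2) \<le> angle T' (i + 2)"
proof -
  define d where "d j = log_edge T j - log_edge T' j" for j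
  have area: "area T = area T'" using assms by (simp add: nonobtuse_triangles_def)
  have i0: "d (i + 1) + d (i + 2) \<le> 0 \<longleftrightarrow> angle T' i \<le> angle T i"
    and i1: "0 \<le> d (i + 2) + d i \<longleftrightarrow> angle T (i + 1) \<le> angle T' (i + 1)"
    and i2: "0 \<le> d i + d (i + 1) \<longleftrightarrow> angle T (i + 2) \<le> angle T' (i + 2)"
    using log_edge_add_le_iff[OF assms(2,1), of i]
      log_edge_add_le_iff[OF assms, of "i + 1"] log_edge_add_le_iff[OF assms, of "i + 2"]
    unfolding add_simps_3 d_def by linarith+
  have "triangle_dist T T' = d i \<longleftrightarrow> (\<forall>j. \<bar>d j\<bar> \<le> d i)"
  proof
    assume "triangle_dist T T' = d i"
    then show "\<forall>j. \<bar>d j\<bar> \<le> d i"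
      using triangle_dist_ge[OF area] by (auto simp: d_def abs_minus_commute)
  next
    assume *: "\<forall>j. \<bar>d j\<bar> \<le> d i"
    obtain j where "triangle_dist T T' = \<bar>d j\<bar>"
      using triangle_dist_cases[OF area] by (metis d_def abs_minus_commute)
    moreover have "d i \<le> triangle_dist T T'"
      using triangle_dist_ge[OF area, of i] by (simp add: d_def)
    ultimately show "triangle_dist T T' = d i" using *[rule_format, of j] by linarith
  qed
  also have "\<dots> \<longleftrightarrow> \<bar>d i\<bar> \<le> d i \<and> \<bar>d (i + 1)\<bar> \<le> d i \<and> \<bar>d (i + 2)\<bar> \<le> d i"
    using cyclic_exhaust_3[of _ i] by metis
  also have "\<dots> \<longleftrightarrow> angle T (i + 1) \<le> angle T' (i + 1) \<and> angle T (i + 2) \<le> angle T' (i + 2)"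
  (is "?L \<longleftrightarrow> ?R")
  proof
    assume ?L
    then show ?R using i1 i2 by linarith
  next
    \<comment> \<open>The angle sum makes the third angle shrink, so
      \<open>d (i + 1) + d (i + 2) \<le> 0\<close>. Hence
      \<open>d (i + 1) \<le> - d (i + 2) \<le> d i\<close>, likewise with the two indices exchanged,
      and adding \<open>i1\<close> and \<open>i2\<close> gives \<open>0 \<le> d i\<close>.\<close>
    assume R: ?R
    then have "angle T' i \<le> angle T i"
      using angle_sum[of T i] angle_sum[of T' i] by linarith
    then show ?L using R i0 i1 i2 by linarith
  qed
  finally show ?thesis by (simp add: d_def)
qed

subsection \<open>Geodesics\<close>

text \<open>Signed increments of \<open>log_edge\<close> never exceed the distance, and both are
  additive along the path. Equality over the whole interval therefore forces equality on every
  piece. The sign \<open>\<sigma>\<close> treats shrinking and growing edges together.\<close>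

lemma log_edge_diff_on_subinterval:
  fixes \<sigma> :: real
  assumes geo: "geodesic_on X triangle_dist {a..b} T" and area: "\<And>T. T \<in> X \<Longrightarrow> area T = A"
    and ends: "triangle_dist (T a) (T b) = \<sigma> * (log_edge (T a) i - log_edge (T b) i)"
    and \<sigma>: "\<bar>\<sigma>\<bar> = 1"
    and st: "a \<le> s" "s \<le> t" "t \<le> b"
  shows "triangle_dist (T s) (T t) = \<sigma> * (log_edge (T s) i - log_edge (T t) i)"
proof -
  have ge: "\<sigma> * (log_edge (T x) i - log_edge (T y) i) \<le> triangle_dist (T x) (T y)"
    if "x \<in> {a..b}" "y \<in> {a..b}" for x y
  proof -
    have "area (T x) = area (T y)"
      using that geo area unfolding geodesic_on_def by (metis image_subset_iff)
    then have "\<bar>log_edge (T y) i - log_edge (T x) i\<bar> \<le> triangle_dist (T x) (T y)"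
      by (rule triangle_dist_ge)
    then show ?thesis using \<sigma> by (auto simp: abs_if split: if_splits)
  qed
  have add: "triangle_dist (T x) (T z) = triangle_dist (T x) (T y) + triangle_dist (T y) (T z)"
    if "a \<le> x" "x \<le> y" "y \<le> z" "z \<le> b" for x y z
    using geo that unfolding geodesic_on_def by auto
  show ?thesis
    \<comment> \<open>Splitting at \<open>s\<close> and \<open>t\<close> gives three inequalities
      whose sum is the equality \<open>ends\<close>.\<close>
    using add[of a s b] add[of s t b] ge[of a s] ge[of s t] ge[of t b] ends st
    by (simp add: algebra_simps)
qed

lemma mono_or_antimono_angles_imp_additive:
  fixes T :: "real \<Rightarrow> triangle"
  assumes T: "\<And>t. t \<in> {a..b} \<Longrightarrow> T t \<in> nonobtuse_triangles A"
    and mono: "\<And>i. mono_on {a..b} (\<lambda>t. angle (T t) i) \<or> antimono_on {a..b} (\<lambda>t. angle (T t) i)"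
    and xyz: "a \<le> x" "x \<le> y" "y \<le> z" "z \<le> b"
  shows "triangle_dist (T x) (T z) = triangle_dist (T x) (T y) + triangle_dist (T y) (T z)"
proof -
  let ?m = "\<lambda>i. mono_on {a..b} (\<lambda>t. angle (T t) i)"
  let ?a = "\<lambda>i. antimono_on {a..b} (\<lambda>t. angle (T t) i)"
  have comm: "triangle_dist (T s) (T t) = triangle_dist (T t) (T s)"
    if "s \<in> {a..b}" "t \<in> {a..b}" for s t
    using T[OF that(1)] T[OF that(2)]
    by (intro triangle_dist_commute) (simp add: nonobtuse_triangles_def)
  \<comment> \<open>Pigeonhole: three angles with two possible directions; \<open>i\<close> is the
    index left over by an agreeing pair.\<close>
  have "\<exists>i. ?m (i + 1) \<and> ?m (i + 2) \<or> ?a (i + 1) \<and> ?a (i + 2)"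
  proof -
    have "(3 :: 3) + 1 = 1" "(3 :: 3) + 2 = 2" "(2 :: 3) + 1 = 3" "(2 :: 3) + 2 = 1"
      "(1 :: 3) + 1 = 2" "(1 :: 3) + 2 = 3"
      by simp_all
    then show ?thesis using mono[of 1] mono[of 2] mono[of 3] by metis
  qed
  then obtain i where "?m (i + 1) \<and> ?m (i + 2) \<or> ?a (i + 1) \<and> ?a (i + 2)" ..
  then show ?thesis
  proof
    assume m: "?m (i + 1) \<and> ?m (i + 2)"
    have "triangle_dist (T s) (T t) = log_edge (T s) i - log_edge (T t) i"
      if "a \<le> s" "s \<le> t" "t \<le> b" for s t
      using that m triangle_dist_eq_log_edge_diff_iff[OF T T, of s t i]
      by (auto simp: monotone_on_def)
    then show ?thesis using xyz by simp
  next
    \<comment> \<open>Reversing time turns decreasing angles into increasing ones, so the criterion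
      is applied to \<open>T t\<close> and \<open>T s\<close> in this order and symmetry restores
      the original one.\<close>
    assume m: "?a (i + 1) \<and> ?a (i + 2)"
    have "triangle_dist (T t) (T s) = log_edge (T t) i - log_edge (T s) i"
      if "a \<le> s" "s \<le> t" "t \<le> b" for s t
      using that m triangle_dist_eq_log_edge_diff_iff[OF T T, of t s i]
      by (auto simp: monotone_on_def)
    then show ?thesis using xyz comm by simp
  qed
qed

theorem theorem5:
  fixes A a b :: real and T :: "real \<Rightarrow> triangle"
  assumes "A > 0"
    and "a \<le> b"
    and "\<forall>t\<in>{a..b}. T t \<in> nonobtuse_triangles A"
    and "continuous_path_on triangle_dist {a..b} T"
    and "nowhere_constant_on {a..b} T"
  shows "geodesic_on (nonobtuse_triangles A) triangle_dist {a..b} T \<longleftrightarrow>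
    (\<forall>i. mono_on {a..b} (\<lambda>t. angle (T t) i) \<or> antimono_on {a..b} (\<lambda>t. angle (T t) i))"
proof
  assume geo: "geodesic_on (nonobtuse_triangles A) triangle_dist {a..b} T"
  have T: "T t \<in> nonobtuse_triangles A" if "t \<in> {a..b}" for t using assms(3) that by blast
  then have area: "area (T t) = A" if "t \<in> {a..b}" for t
    using that by (simp add: nonobtuse_triangles_def)
  have "area (T a) = area (T b)" using area assms(2) by simp
  then obtain i where "triangle_dist (T a) (T b) = \<bar>log_edge (T b) i - log_edge (T a) i\<bar>"
    by (rule triangle_dist_cases)
  then consider "triangle_dist (T a) (T b) = 1 * (log_edge (T a) i - log_edge (T b) i)"
    | "triangle_dist (T a) (T b) = - 1 * (log_edge (T a) i - log_edge (T b) i)"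
    by (cases "log_edge (T b) i \<le> log_edge (T a) i") auto
  \<comment> \<open>The index and sign found at the endpoints serve for all pairs; the case names
    describe the length of edge \<open>i\<close>. In the second case the arguments are exchanged to
    fit \<open>triangle_dist_eq_log_edge_diff_iff\<close>.\<close>
  then consider
    (decreasing) "\<And>s t. a \<le> s \<Longrightarrow> s \<le> t \<Longrightarrow> t \<le> b \<Longrightarrow>
      triangle_dist (T s) (T t) = log_edge (T s) i - log_edge (T t) i"
    | (increasing) "\<And>s t. a \<le> s \<Longrightarrow> s \<le> t \<Longrightarrow> t \<le> b \<Longrightarrow>
      triangle_dist (T t) (T s) = log_edge (T t) i - log_edge (T s) i"
  proof cases
    case 1
    show ?thesis
      using log_edge_diff_on_subinterval[OF geo _ 1]
      by (intro that(1)) (simp add: nonobtuse_triangles_def)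
  next
    case 2
    show ?thesis
    proof (rule that(2))
      fix s t assume st: "a \<le> s" "s \<le> t" "t \<le> b"
      have "triangle_dist (T t) (T s) = triangle_dist (T s) (T t)"
        using st area by (intro triangle_dist_commute) simp
      then show "triangle_dist (T t) (T s) = log_edge (T t) i - log_edge (T s) i"
        using log_edge_diff_on_subinterval[OF geo _ 2 _ st] by (simp add: nonobtuse_triangles_def)
    qed
  qed
  then show "\<forall>j. mono_on {a..b} (\<lambda>t. angle (T t) j) \<or> antimono_on {a..b} (\<lambda>t. angle (T t) j)"
  proof cases
    case decreasing
    then have le: "angle (T s) (i + 1) \<le> angle (T t) (i + 1)" "angle (T s) (i + 2) \<le> angle (T t) (i + 2)"
      if "a \<le> s" "s \<le> t" "t \<le> b" for s t
      using that T triangle_dist_eq_log_edge_diff_iff[of "T s" A "T t" i] by simp_all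
    \<comment> \<open>The remaining angle moves in the opposite direction because the sum is
      pi.\<close>
    moreover have "angle (T t) i \<le> angle (T s) i" if "a \<le> s" "s \<le> t" "t \<le> b" for s t
      using le[OF that] angle_sum[of "T s" i] angle_sum[of "T t" i] by linarith
    ultimately have "antimono_on {a..b} (\<lambda>t. angle (T t) i)"
      "mono_on {a..b} (\<lambda>t. angle (T t) (i + 1))" "mono_on {a..b} (\<lambda>t. angle (T t) (i + 2))"
      by (auto simp: monotone_on_def)
    then show ?thesis using cyclic_exhaust_3[of _ i] by metis
  next
    case increasing
    then have le: "angle (T t) (i + 1) \<le> angle (T s) (i + 1)" "angle (T t) (i + 2) \<le> angle (T s) (i + 2)"
      if "a \<le> s" "s \<le> t" "t \<le> b" for s t
      using that T triangle_dist_eq_log_edge_diff_iff[of "T t" A "T s" i] by simp_all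
    moreover have "angle (T s) i \<le> angle (T t) i" if "a \<le> s" "s \<le> t" "t \<le> b" for s t
      using le[OF that] angle_sum[of "T s" i] angle_sum[of "T t" i] by linarith
    ultimately have "mono_on {a..b} (\<lambda>t. angle (T t) i)"
      "antimono_on {a..b} (\<lambda>t. angle (T t) (i + 1))" "antimono_on {a..b} (\<lambda>t. angle (T t) (i + 2))"
      by (auto simp: monotone_on_def)
    then show ?thesis using cyclic_exhaust_3[of _ i] by metis
  qed
next
  assume "\<forall>i. mono_on {a..b} (\<lambda>t. angle (T t) i) \<or> antimono_on {a..b} (\<lambda>t. angle (T t) i)"
  then show "geodesic_on (nonobtuse_triangles A) triangle_dist {a..b} T"
    using assms mono_or_antimono_angles_imp_additive[of a b T A]
    unfolding geodesic_on_def by auto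
qed

end
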